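(* For every $t>0$, $$E\Big[\exp\Big(\frac{2}{\int_0^t\exp(B_s)\,ds}\Big)\Big]=\infty.$$
   Context: $(B_t)_{t\ge 0}$ is a standard one-dimensional Brownian motion started at $0$. *)

theory Defs
  imports "HOL-Probability.Probability"
begin

text \<open>
  The normalisation at time 0 and the continuity of paths are required almost surely only, so
  that versions with exceptional null sets are covered.  Times are reals, and nothing is assumed
  about \<open>B s\<close> for \<open>s < 0\<close>.
\<close>

locale standard_brownian_motion = prob_space M
  for M :: "'a measure" and B :: "real \<Rightarrow> 'a \<Rightarrow> real" +
  assumes random_variable_B: "\<And>s. 0 \<le> s \<Longrightarrow> random_variable borel (B s)"
    and start_zero: "AE \<omega> in M. B 0 \<omega> = 0"
    and indep_increments:
      "\<And>(\<tau> :: nat \<Rightarrow> real) n. 0 \<le> \<tau> 0 \<Longrightarrow> (\<And>i. i < n \<Longrightarrow> \<tau> i < \<tau> (Suc i)) \<Longrightarrow>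
         indep_vars (\<lambda>_. borel) (\<lambda>i \<omega>. B (\<tau> (Suc i)) \<omega> - B (\<tau> i) \<omega>) {..<n}"
    \<comment> \<open>the second parameter of \<open>normal_density\<close> is the standard deviation\<close>
    and normal_increments:
      "\<And>s u. 0 \<le> s \<Longrightarrow> s < u \<Longrightarrow>
         distributed M lborel (\<lambda>\<omega>. B u \<omega> - B s \<omega>) (normal_density 0 (sqrt (u - s)))"
    and continuous_paths: "AE \<omega> in M. continuous_on {0..} (\<lambda>s. B s \<omega>)"

end

theory Submission
  imports Defs
begin

text \<open>
  Write \<open>A\<close> for the integral of \<open>exp (B s)\<close> over \<open>[0, t]\<close>.  The function \<open>g r = exp (- r) / sqrt (1 + r)\<close>
  satisfies \<open>r\<^sup>2 g'' + r g' - r\<^sup>2 g \<ge> - (3/2) g\<close>, so \<open>x \<mapsto> g (\<xi> exp (x/2))\<close> is a bounded subsolution of the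
  Feynman-Kac equation with potential \<open>\<xi>\<^sup>2 exp x / 8\<close>, up to the spectral shift \<open>3/16\<close>.  Running the
  corresponding submartingale along a time grid gives
  \<open>E (exp (- \<xi>\<^sup>2 A / 8)) \<ge> exp (- 3 t / 16) exp (- \<xi>) / sqrt (1 + \<xi>)\<close>.  On the other hand, completing the
  square shows that the integral of \<open>exp (\<xi> - \<xi>\<^sup>2 a / 8) / sqrt (1 + \<xi>)\<close> over \<open>\<xi> \<ge> 0\<close> is at most a
  constant times \<open>exp (2 / a)\<close>, uniformly in \<open>a > 0\<close>.  By Tonelli, \<open>E (exp (2 / A))\<close> dominates a multiple
  of the divergent integral of \<open>1 / (1 + \<xi>)\<close>.
\<close>

section \<open>The subsolution and its local quadratic lower bound\<close>

text \<open>An elementary stand-in for the Macdonald function \<open>K_0\<close> at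
  \<open>r = \<xi> * exp (x / 2)\<close>. \<open>K_0\<close> solves
  \<open>r^2 g'' + r g' = r^2 g\<close> but has a logarithmic singularity at \<open>r = 0\<close>;
  here the decay \<open>exp (- r) / sqrt r\<close> survives up to a constant, while
  \<open>1 + r\<close> keeps the function bounded.\<close>

definition subsol :: "real \<Rightarrow> real \<Rightarrow> real" where
  "subsol \<xi> x = exp (- (\<xi> * exp (x / 2))) / sqrt (1 + \<xi> * exp (x / 2))"

text \<open>Lets the decay of \<open>subsol\<close> absorb polynomial factors in \<open>r\<close>:
  cubic ones in the third derivative, quartic ones in the squared potential.\<close>

lemma power_exp_neg_le:
  fixes r :: real
  assumes "r \<ge> 0" "n > 0"
  shows "r ^ n * exp (- r) \<le> real n ^ n"
proof -
  have "r / n \<le> exp (r / n)"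
    using exp_ge_add_one_self[of "r / n"] by linarith
  then have "(r / n) ^ n \<le> exp (r / n) ^ n"
    using assms by (intro power_mono) auto
  also have "\<dots> = exp r"
    using assms by (simp flip: exp_of_nat_mult)
  finally have "r ^ n \<le> real n ^ n * exp r"
    using assms by (simp add: power_divide field_simps)
  then show ?thesis
    by (simp add: exp_minus field_simps)
qed

lemma subsol_pos: "\<xi> \<ge> 0 \<Longrightarrow> 0 < subsol \<xi> x"
  by (auto simp: subsol_def intro!: divide_pos_pos add_pos_nonneg)

lemma subsol_le_exp: "\<xi> \<ge> 0 \<Longrightarrow> subsol \<xi> x \<le> exp (- (\<xi> * exp (x / 2)))"
  by (auto simp: subsol_def divide_le_eq add_pos_nonneg)

lemma subsol_le_1: "\<xi> \<ge> 0 \<Longrightarrow> subsol \<xi> x \<le> 1"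
  by (rule order_trans[OF subsol_le_exp]) auto

lemma borel_measurable_subsol [measurable]: "subsol \<xi> \<in> borel_measurable borel"
  unfolding subsol_def[abs_def] by measurable

text \<open>Taylor expansion to second order, with half the second derivative bounded below by the
  subsolution inequality and the third derivative bounded uniformly in \<open>x\<close>. The slope
  \<open>d\<close> stays unspecified because it integrates to zero against a centred
  Gaussian.\<close>

lemma subsol_quadratic_minorant:
  assumes "\<xi> \<ge> 0"
  obtains d where
    "\<And>y. subsol \<xi> (x + y) \<ge> subsol \<xi> x + d * y + (\<xi>\<^sup>2 * exp x / 8 - 3 / 16) * subsol \<xi> x * y\<^sup>2 - 9 * \<bar>y\<bar> ^ 3"
proof -
  define r where "r u = \<xi> * exp (u / 2)" for u
  define s where "s u = 1 / (1 + r u)" for u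
  \<comment> \<open>\<open>p / 2\<close> is the logarithmic derivative of \<open>subsol \<xi>\<close>; with \<open>r s = 1 - s\<close> all derivatives stay
    polynomial in \<open>r\<close> and \<open>s\<close>\<close>
  define p where "p u = - r u - 1 / 2 + s u / 2" for u
  define p1 where "p1 u = - r u + ((s u)\<^sup>2 - s u) / 2" for u
  define p2 where "p2 u = - r u + (2 * s u - 1) * ((s u)\<^sup>2 - s u) / 2" for u
  have r0: "r u \<ge> 0" for u using assms by (simp add: r_def)
  have s0: "s u > 0" and s1: "s u \<le> 1" for u
    using r0[of u] by (auto simp: s_def add_pos_nonneg)
  have rs: "r u * s u = 1 - s u" for u
    using r0[of u] by (simp add: s_def field_simps)
  have dr: "(r has_real_derivative r u / 2) (at u)" for u
    unfolding r_def by (auto intro!: derivative_eq_intros)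
  have ds: "(s has_real_derivative ((s u)\<^sup>2 - s u) / 2) (at u)" for u
  proof -
    have "(s has_real_derivative - (r u / 2) * (s u)\<^sup>2) (at u)"
      unfolding s_def using r0[of u]
      by (auto intro!: derivative_eq_intros dr simp: power2_eq_square field_simps)
    also have "- (r u / 2) * (s u)\<^sup>2 = - (r u * s u) * s u / 2"
      by (simp add: power2_eq_square)
    also have "\<dots> = ((s u)\<^sup>2 - s u) / 2"
      unfolding rs by (simp add: power2_eq_square algebra_simps)
    finally show ?thesis .
  qed
  have dp: "(p has_real_derivative p1 u / 2) (at u)" for u
    unfolding p_def p1_def
    by (auto intro!: derivative_eq_intros dr ds simp: field_simps)
  have dp1: "(p1 has_real_derivative p2 u / 2) (at u)" for u
    unfolding p1_def p2_def
    by (auto intro!: derivative_eq_intros dr ds simp: power2_eq_square field_simps)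
  have subsol_eq: "subsol \<xi> u = exp (- r u - ln (1 + r u) / 2)" for u
    using r0[of u]
    by (simp add: subsol_def r_def exp_diff powr_half_sqrt[symmetric] powr_def add_pos_nonneg)
  have df: "(subsol \<xi> has_real_derivative p u / 2 * subsol \<xi> u) (at u)" for u
  proof -
    have "((\<lambda>u. - r u - ln (1 + r u) / 2) has_real_derivative - (r u / 2) - r u / 2 * s u / 2) (at u)"
      unfolding s_def using r0[of u]
      by (auto intro!: derivative_eq_intros dr simp: add_pos_nonneg) (simp add: divide_simps)
    also have "- (r u / 2) - r u / 2 * s u / 2 = - (r u / 2) - (r u * s u) / 4"
      by simp
    also have "\<dots> = p u / 2"
      unfolding rs p_def by (simp add: field_simps)
    finally have "((\<lambda>u. exp (- r u - ln (1 + r u) / 2)) has_real_derivative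
        exp (- r u - ln (1 + r u) / 2) * (p u / 2)) (at u)"
      by (rule DERIV_chain2[OF DERIV_exp])
    then show ?thesis
      unfolding subsol_eq[abs_def] by (simp add: mult_ac)
  qed
  \<comment> \<open>The first three derivatives of \<open>subsol \<xi>\<close>: differentiating
    \<open>F * subsol \<xi>\<close> replaces the factor \<open>F\<close> by
    \<open>F' + F * p / 2\<close>.\<close>
  define f1 where "f1 u = p u / 2 * subsol \<xi> u" for u
  define f2 where "f2 u = ((p u)\<^sup>2 + p1 u) / 4 * subsol \<xi> u" for u
  define f3 where "f3 u = (p u ^ 3 + 3 * p u * p1 u + p2 u) / 8 * subsol \<xi> u" for u
  have d1: "(f1 has_real_derivative f2 u) (at u)" for u
    unfolding f1_def f2_def
    by (auto intro!: derivative_eq_intros df dp simp: power2_eq_square field_simps)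
  have d2: "(f2 has_real_derivative f3 u) (at u)" for u
    unfolding f2_def f3_def
    by (auto intro!: derivative_eq_intros df dp dp1 simp: power2_eq_square power3_eq_cube field_simps)
  \<comment> \<open>The polynomial factor is at most \<open>5 * (r + 1)^3 / 8\<close>, which
    \<open>exp (- r)\<close> beats. With \<open>exp 1 \<le> 3\<close> this gives about 50.6; the
    round value 54 becomes 9 after division by \<open>fact 3\<close>.\<close>
  have f3: "\<bar>f3 u\<bar> \<le> 54" for u
  proof -
    have ss: "s u - (s u)\<^sup>2 \<ge> 0" "s u - (s u)\<^sup>2 \<le> 1"
      using s0[of u] s1[of u] by (auto simp: power2_eq_square mult_le_cancel_right1)
        (smt (verit) mult_nonneg_nonneg)
    have P: "\<bar>p u\<bar> \<le> r u + 1"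
      unfolding p_def using r0[of u] s0[of u] s1[of u] by (simp add: abs_le_iff)
    have P1: "\<bar>p1 u\<bar> \<le> r u + 1"
      unfolding p1_def using r0[of u] ss by (simp add: abs_le_iff)
    have "\<bar>(2 * s u - 1) * ((s u)\<^sup>2 - s u)\<bar> \<le> 1 * 1"
      unfolding abs_mult using s0[of u] s1[of u] ss by (intro mult_mono) auto
    then have P2: "\<bar>p2 u\<bar> \<le> r u + 1"
      unfolding p2_def using r0[of u] by (simp add: abs_le_iff)
    let ?R = "r u + 1"
    have "\<bar>p u ^ 3 + 3 * p u * p1 u + p2 u\<bar> \<le> \<bar>p u\<bar> ^ 3 + 3 * (\<bar>p u\<bar> * \<bar>p1 u\<bar>) + \<bar>p2 u\<bar>"
      using abs_triangle_ineq[of "p u ^ 3 + 3 * p u * p1 u" "p2 u"]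
        abs_triangle_ineq[of "p u ^ 3" "3 * p u * p1 u"]
      by (simp add: abs_mult power_abs)
    also have "\<dots> \<le> ?R ^ 3 + 3 * (?R * ?R) + ?R"
      using P P1 P2 r0[of u] by (intro add_mono power_mono mult_left_mono mult_mono) auto
    also have "\<dots> \<le> ?R ^ 3 + 3 * ?R ^ 3 + ?R ^ 3"
    proof -
      have "?R * ?R * 1 \<le> ?R * ?R * ?R" using r0[of u] by (intro mult_left_mono) auto
      moreover have "?R * 1 \<le> ?R * (?R * ?R)"
        using r0[of u] mult_mono[of 1 ?R 1 ?R] by (intro mult_left_mono) auto
      ultimately show ?thesis by (simp add: power3_eq_cube mult.assoc)
    qed
    finally have *: "\<bar>p u ^ 3 + 3 * p u * p1 u + p2 u\<bar> \<le> 5 * ?R ^ 3" by simp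
    have "\<bar>f3 u\<bar> \<le> 5 * ?R ^ 3 / 8 * exp (- r u)"
      unfolding f3_def abs_mult
      using * subsol_pos[OF assms, of u] subsol_le_exp[OF assms, of u] r0[of u]
      by (intro mult_mono) (auto simp: r_def)
    also have "\<dots> = 5 / 8 * exp 1 * (?R ^ 3 * exp (- ?R))"
      by (simp add: exp_diff exp_minus field_simps)
    also have "\<dots> \<le> 5 / 8 * exp 1 * 27"
      using power_exp_neg_le[of ?R 3] r0[of u] by (intro mult_left_mono) auto
    finally show ?thesis using exp_le by simp
  qed
  \<comment> \<open>The subsolution inequality in the variable \<open>x\<close>; the chain rule
    supplies the factor 1/4. The square root in \<open>subsol\<close> makes the terms linear in
    \<open>r\<close> cancel in \<open>p^2 + p1\<close>, so that only \<open>r^2\<close> and a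
    bounded remainder are left.\<close>
  have f2: "(\<xi>\<^sup>2 * exp x / 8 - 3 / 16) * subsol \<xi> x \<le> f2 x / 2"
  proof -
    have "(p x)\<^sup>2 + p1 x = (r x)\<^sup>2 - r x * s x + (1 - s x)\<^sup>2 / 4 - s x * (1 - s x) / 2"
      unfolding p_def p1_def by (simp add: power2_eq_square field_simps)
    also have "\<dots> = (r x)\<^sup>2 - (1 - s x) + (1 - s x)\<^sup>2 / 4 - s x * (1 - s x) / 2"
      unfolding rs ..
    also have "\<dots> \<ge> (r x)\<^sup>2 - 3 / 2"
    proof -
      have "s x * (1 - s x) \<le> 1 * 1" using s0[of x] s1[of x] by (intro mult_mono) auto
      then show ?thesis using s0[of x] zero_le_power2[of "1 - s x"] by argo
    qed
    finally have "(r x)\<^sup>2 - 3 / 2 \<le> (p x)\<^sup>2 + p1 x" .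
    moreover have "(r x)\<^sup>2 = \<xi>\<^sup>2 * exp x"
      unfolding r_def by (simp add: power_mult_distrib flip: exp_of_nat_mult)
    ultimately show ?thesis
      unfolding f2_def using subsol_pos[OF assms, of x]
      by (simp add: mult_right_mono)
  qed
  show ?thesis
  proof (rule that)
    fix y
    \<comment> \<open>The Maclaurin formula wants the derivatives as a family indexed by their
      order; the last branch matters only at order 3.\<close>
    define D where "D m u = (if m = 0 then subsol \<xi> (x + u) else if m = 1 then f1 (x + u)
      else if m = 2 then f2 (x + u) else f3 (x + u))" for m :: nat and u
    have shift: "((\<lambda>u. f (x + u)) has_real_derivative f') (at u)"
      if "(f has_real_derivative f') (at (x + u))" for f f' u
      using that by (simp add: DERIV_shift add.commute)
    have "\<exists>u. \<bar>u\<bar> \<le> \<bar>y\<bar> \<and> subsol \<xi> (x + y) = (\<Sum>m<3. D m 0 / fact m * y ^ m) + D 3 u / fact 3 * y ^ 3"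
    proof (rule Maclaurin_bi_le, goal_cases)
      case 1 show ?case by (simp add: D_def fun_eq_iff)
    next
      case 2
      have "DERIV (D m) u :> D (Suc m) u" if "m < 3" for m u
      proof -
        from that consider "m = 0" | "m = 1" | "m = 2" by linarith
        then show ?thesis
        proof cases
          case 1 then show ?thesis
            using shift[OF df[of "x + u"]] by (simp add: D_def[abs_def] f1_def)
        next
          case 2 then show ?thesis
            using shift[OF d1[of "x + u"]] by (simp add: D_def[abs_def])
        next
          case 3 then show ?thesis
            using shift[OF d2[of "x + u"]] by (simp add: D_def[abs_def])
        qed
      qed
      then show ?case by blast
    qed
    then obtain u where u: "subsol \<xi> (x + y) = subsol \<xi> x + f1 x * y + f2 x / 2 * y\<^sup>2 + f3 (x + u) / 6 * y ^ 3"
      by (auto simp: D_def numeral_3_eq_3 power2_eq_square)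
    have "\<bar>f3 (x + u) / 6 * y ^ 3\<bar> \<le> 9 * \<bar>y\<bar> ^ 3"
      unfolding abs_mult power_abs using f3[of "x + u"] by (intro mult_mono) auto
    moreover have "(\<xi>\<^sup>2 * exp x / 8 - 3 / 16) * subsol \<xi> x * y\<^sup>2 \<le> f2 x / 2 * y\<^sup>2"
      using f2 by (intro mult_right_mono) auto
    ultimately show "subsol \<xi> x + f1 x * y + (\<xi>\<^sup>2 * exp x / 8 - 3 / 16) * subsol \<xi> x * y\<^sup>2 - 9 * \<bar>y\<bar> ^ 3
        \<le> subsol \<xi> (x + y)"
      unfolding u by linarith
  qed
qed

section \<open>Gaussian random walks with exponential killing\<close>

text \<open>Integrate the quadratic minorant against the centred Gaussian: the linear term vanishes,
  and the third absolute moment \<open>2 * \<sigma>^3 * sqrt (2 / pi)\<close> turns the remainder 9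
  into at most \<open>18 * \<sigma>^3\<close>. The second moment yields a growth factor
  \<open>1 + \<sigma>^2 * q\<close>, which the killing factor
  \<open>exp (- (\<sigma>^2 * q))\<close> cancels up to second order.\<close>

lemma normal_density_subsol_step:
  assumes "\<xi> \<ge> 0" "\<sigma> > 0"
  shows "(1 - 3 / 16 * \<sigma>\<^sup>2) * subsol \<xi> x - (4 * \<sigma> ^ 4 + 18 * \<sigma> ^ 3)
    \<le> exp (- (\<sigma>\<^sup>2 * (\<xi>\<^sup>2 * exp x / 8))) * (\<integral>y. subsol \<xi> (x + y) \<partial>density lborel (normal_density 0 \<sigma>))"
proof -
  define q where "q = \<xi>\<^sup>2 * exp x / 8"
  have q0: "q \<ge> 0" by (simp add: q_def)
  define f where "f = subsol \<xi> x"
  have f0: "f \<ge> 0" using subsol_pos[OF assms(1), of x] by (simp add: f_def)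
  define I where "I = (\<integral>y. subsol \<xi> (x + y) \<partial>density lborel (normal_density 0 \<sigma>))"
  interpret N: prob_space "density lborel (normal_density 0 \<sigma>)"
    using prob_space_normal_density[OF assms(2)] .
  obtain d where d: "\<And>y. subsol \<xi> (x + y) \<ge> f + d * y + (q - 3 / 16) * f * y\<^sup>2 - 9 * \<bar>y\<bar> ^ 3"
    using subsol_quadratic_minorant[OF assms(1), of x] unfolding q_def f_def by blast
  let ?n = "normal_density 0 \<sigma>"
  have m0: "has_bochner_integral lborel ?n 1"
    using normal_moment_even[OF assms(2), of 0 0] by simp
  have m1: "has_bochner_integral lborel (\<lambda>y. ?n y * y) 0"
    using normal_moment_odd[OF assms(2), of 0 0] by simp
  have m2: "has_bochner_integral lborel (\<lambda>y. ?n y * y\<^sup>2) (\<sigma>\<^sup>2)"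
    using normal_moment_even[OF assms(2), of 0 1] by (simp add: fact_2)
  have m3: "has_bochner_integral lborel (\<lambda>y. ?n y * \<bar>y\<bar> ^ 3) (2 * \<sigma> ^ 3 * sqrt (2 / pi))"
    using normal_moment_abs_odd[OF assms(2), of 0 1] by (simp add: numeral_3_eq_3)
  have "has_bochner_integral lborel
      (\<lambda>y. ?n y * f + ?n y * y * d + ?n y * y\<^sup>2 * ((q - 3 / 16) * f) - ?n y * \<bar>y\<bar> ^ 3 * 9)
      (1 * f + 0 * d + \<sigma>\<^sup>2 * ((q - 3 / 16) * f) - 2 * \<sigma> ^ 3 * sqrt (2 / pi) * 9)"
    by (intro has_bochner_integral_add has_bochner_integral_diff has_bochner_integral_mult_left m0 m1 m2 m3)
  then have J: "has_bochner_integral lborel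
      (\<lambda>y. ?n y * (f + d * y + (q - 3 / 16) * f * y\<^sup>2 - 9 * \<bar>y\<bar> ^ 3))
      (f + \<sigma>\<^sup>2 * ((q - 3 / 16) * f) - 18 * (\<sigma> ^ 3 * sqrt (2 / pi)))"
    by (simp add: algebra_simps)
  have int: "integrable (density lborel ?n) (\<lambda>y. subsol \<xi> (x + y))"
    by (rule N.integrable_const_bound[where B = 1])
       (auto simp: subsol_le_1[OF assms(1)] less_imp_le[OF subsol_pos[OF assms(1)]])
  have I_eq: "I = (\<integral>y. ?n y * subsol \<xi> (x + y) \<partial>lborel)"
    unfolding I_def by (subst integral_density) auto
  have "f + \<sigma>\<^sup>2 * ((q - 3 / 16) * f) - 18 * (\<sigma> ^ 3 * sqrt (2 / pi)) \<le> I"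
    unfolding I_eq has_bochner_integral_integral_eq[OF J, symmetric]
  proof (rule integral_mono)
    show "integrable lborel (\<lambda>y. ?n y * subsol \<xi> (x + y))"
      using int by (subst (asm) integrable_density) auto
  qed (use J d in \<open>auto intro!: mult_left_mono simp: has_bochner_integral_iff\<close>)
  moreover have "\<sigma> ^ 3 * sqrt (2 / pi) \<le> \<sigma> ^ 3 * 1"
    using assms(2) pi_ge_two by (intro mult_left_mono) auto
  ultimately have I_ge: "(1 + \<sigma>\<^sup>2 * q) * f - 3 / 16 * \<sigma>\<^sup>2 * f - 18 * \<sigma> ^ 3 \<le> I"
    by (simp add: algebra_simps)
  define e where "e = exp (- (\<sigma>\<^sup>2 * q))"
  have e: "0 \<le> e" "e \<le> 1" using q0 by (auto simp: e_def)
  \<comment> \<open>From \<open>1 - a \<le> exp (- a)\<close>, multiplied by the nonnegative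
    \<open>1 + a\<close>, with \<open>a = \<sigma>^2 * q\<close>.\<close>
  have "1 - (\<sigma>\<^sup>2 * q)\<^sup>2 = (1 - \<sigma>\<^sup>2 * q) * (1 + \<sigma>\<^sup>2 * q)"
    by (simp add: power2_eq_square algebra_simps)
  also have "\<dots> \<le> e * (1 + \<sigma>\<^sup>2 * q)"
    using exp_ge_add_one_self[of "- (\<sigma>\<^sup>2 * q)"] q0 unfolding e_def by (intro mult_right_mono) auto
  finally have "(1 - (\<sigma>\<^sup>2 * q)\<^sup>2) * f \<le> e * (1 + \<sigma>\<^sup>2 * q) * f"
    using f0 by (intro mult_right_mono)
  moreover have "e * (3 / 16 * \<sigma>\<^sup>2 * f) \<le> 1 * (3 / 16 * \<sigma>\<^sup>2 * f)" "e * (18 * \<sigma> ^ 3) \<le> 1 * (18 * \<sigma> ^ 3)"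
    using e f0 assms(2) by (intro mult_right_mono; simp)+
  moreover have "e * ((1 + \<sigma>\<^sup>2 * q) * f - 3 / 16 * \<sigma>\<^sup>2 * f - 18 * \<sigma> ^ 3) \<le> e * I"
    using I_ge e by (intro mult_left_mono)
  \<comment> \<open>The potential \<open>q\<close> is unbounded in \<open>x\<close>, but
    \<open>q = r^2 / 8\<close> and \<open>f \<le> exp (- r)\<close>, so \<open>q^2 * f\<close> is at
    most \<open>4^4 / 64 = 4\<close>.\<close>
  moreover have "(\<sigma>\<^sup>2 * q)\<^sup>2 * f \<le> 4 * \<sigma> ^ 4"
  proof -
    define r where "r = \<xi> * exp (x / 2)"
    have r0: "r \<ge> 0" using assms by (simp add: r_def)
    have "q = r\<^sup>2 / 8"
      unfolding q_def r_def by (simp add: power_mult_distrib flip: exp_of_nat_mult)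
    then have q2: "q\<^sup>2 = r ^ 4 / 64" by (simp only: power2_eq_square power4_eq_xxxx) simp
    have "r ^ 4 * f \<le> r ^ 4 * exp (- r)"
      using subsol_le_exp[OF assms(1), of x] r0 unfolding f_def r_def by (intro mult_left_mono) auto
    then have "q\<^sup>2 * f \<le> 4"
      unfolding q2 using power_exp_neg_le[of r 4] r0 by simp
    then have "\<sigma> ^ 4 * (q\<^sup>2 * f) \<le> \<sigma> ^ 4 * 4" by (intro mult_left_mono) auto
    then show ?thesis by (simp add: power_mult_distrib mult_ac flip: power_mult)
  qed
  ultimately show ?thesis
    unfolding q_def[symmetric] f_def[symmetric] e_def[symmetric] I_def[symmetric]
    by (simp add: algebra_simps)
qed

text \<open>A discrete submartingale argument: integrating out the last increment applies the
  one-step estimate. Each step costs a factor \<open>1 - 3 / 16 * \<sigma>^2\<close>, and the errors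
  add up at most linearly because the weights and this factor lie in \<open>[0, 1]\<close>.\<close>

lemma normal_walk_subsol_bound:
  fixes \<sigma> \<xi> :: real
  defines "N \<equiv> density lborel (normal_density 0 \<sigma>)"
  assumes "\<xi> \<ge> 0" "\<sigma> > 0" "3 / 16 * \<sigma>\<^sup>2 \<le> 1"
  shows "(1 - 3 / 16 * \<sigma>\<^sup>2) ^ k * subsol \<xi> 0 - real k * (4 * \<sigma> ^ 4 + 18 * \<sigma> ^ 3)
    \<le> (\<integral>\<omega>. exp (- (\<xi>\<^sup>2 / 8 * (\<Sum>i<k. \<sigma>\<^sup>2 * exp (\<Sum>j<i. \<omega> j)))) * subsol \<xi> (\<Sum>j<k. \<omega> j) \<partial>PiM {..<k} (\<lambda>_. N))"
proof (induction k)
  case 0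
  show ?case by (simp add: PiM_empty lebesgue_integral_count_space_finite)
next
  case (Suc k)
  interpret N: prob_space N
    unfolding N_def using prob_space_normal_density[OF assms(3)] .
  interpret P: product_prob_space "\<lambda>_::nat. N" "{..<m}" for m :: nat ..
  have N_sets: "sets N = sets borel" by (simp add: N_def)
  define S where "S k \<omega> = (\<Sum>j<k. \<omega> j)" for k and \<omega> :: "nat \<Rightarrow> real"
  define W where "W k \<omega> = exp (- (\<xi>\<^sup>2 / 8 * (\<Sum>i<k. \<sigma>\<^sup>2 * exp (S i \<omega>))))" for k and \<omega> :: "nat \<Rightarrow> real"
  have W01: "0 \<le> W k \<omega>" "W k \<omega> \<le> 1" for k \<omega>
    by (auto simp: W_def intro!: sum_nonneg mult_nonneg_nonneg)
  have f01: "0 \<le> subsol \<xi> x" "subsol \<xi> x \<le> 1" for x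
    using subsol_pos[OF assms(2), of x] subsol_le_1[OF assms(2), of x] by auto
  have comp: "(\<lambda>\<omega>. \<omega> j) \<in> borel_measurable (PiM {..<k} (\<lambda>_. N))" if "j < k" for j k
    using measurable_component_singleton[of j "{..<k}" "\<lambda>_. N"] that
    by (simp add: measurable_cong_sets[OF refl N_sets])
  have S_meas: "S i \<in> borel_measurable (PiM {..<k} (\<lambda>_. N))" if "i \<le> k" for i k
    unfolding S_def[abs_def] using that by (intro borel_measurable_sum comp) auto
  have W_meas: "W k \<in> borel_measurable (PiM {..<k} (\<lambda>_. N))" for k
    unfolding W_def[abs_def]
    by (intro borel_measurable_exp[THEN measurable_compose_rev] borel_measurable_uminus
        borel_measurable_times borel_measurable_sum borel_measurable_const S_meas) auto
  have int: "integrable (PiM {..<k} (\<lambda>_. N)) (\<lambda>\<omega>. W k \<omega> * subsol \<xi> (S k \<omega>))" for k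
    using measurable_compose[OF S_meas[OF order_refl[of k]] borel_measurable_subsol[of \<xi>]] W_meas[of k]
    by (intro P.integrable_const_bound[where B = 1])
       (auto simp: abs_mult W01 f01 intro!: mult_le_one)
  define c where "c = 1 - 3 / 16 * \<sigma>\<^sup>2"
  define E where "E = 4 * \<sigma> ^ 4 + 18 * \<sigma> ^ 3"
  have c: "0 \<le> c" "c \<le> 1" using assms by (auto simp: c_def)
  have E0: "E \<ge> 0" using assms by (auto simp: E_def)
  define J where "J x = (\<integral>y. subsol \<xi> (x + y) \<partial>N)" for x
  have J_meas: "J \<in> borel_measurable borel"
    unfolding J_def[abs_def]
    by (rule N.borel_measurable_lebesgue_integral) (simp add: N_def)
  have J01: "0 \<le> J x" "J x \<le> 1" for x
  proof -
    have "integrable N (\<lambda>y. subsol \<xi> (x + y))"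
      by (rule N.integrable_const_bound[where B = 1]) (auto simp: f01 N_def)
    then have "J x \<le> (\<integral>y. 1 \<partial>N)"
      unfolding J_def by (intro integral_mono) (auto simp: f01)
    then show "J x \<le> 1" by (simp add: N.prob_space)
    show "0 \<le> J x" unfolding J_def by (simp add: integral_nonneg_AE f01)
  qed
  define q where "q x = exp (- (\<sigma>\<^sup>2 * (\<xi>\<^sup>2 * exp x / 8)))" for x
  have q01: "0 \<le> q x" "q x \<le> 1" for x by (auto simp: q_def)
  have q_meas: "q \<in> borel_measurable borel" unfolding q_def[abs_def] by measurable
  \<comment> \<open>The weight samples the walk before each increment, so \<open>W (Suc k)\<close>
    does not involve coordinate \<open>k\<close>; that coordinate enters only through
    \<open>subsol\<close> and is averaged into \<open>J\<close>.\<close>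
  have fiber_eq: "(\<integral>y. W (Suc k) (\<omega> (k := y)) * subsol \<xi> (S (Suc k) (\<omega> (k := y))) \<partial>N)
      = W k \<omega> * (q (S k \<omega>) * J (S k \<omega>))" for \<omega>
  proof -
    have S_upd: "S i (\<omega> (k := y)) = S i \<omega>" if "i \<le> k" for i y
      unfolding S_def using that by (intro sum.cong) auto
    have "(\<Sum>i<k. \<sigma>\<^sup>2 * exp (S i (\<omega> (k := y)))) = (\<Sum>i<k. \<sigma>\<^sup>2 * exp (S i \<omega>))" for y
      by (intro sum.cong) (auto simp: S_upd)
    then have "W (Suc k) (\<omega> (k := y)) = W k \<omega> * q (S k \<omega>)" for y
      unfolding W_def q_def exp_add[symmetric] by (simp add: S_upd algebra_simps)
    moreover have "S (Suc k) (\<omega> (k := y)) = S k \<omega> + y" for y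
      using S_upd[of k y] by (simp add: S_def)
    ultimately show ?thesis
      by (simp add: mult.assoc J_def)
  qed
  have fiber_ge: "c * (W k \<omega> * subsol \<xi> (S k \<omega>)) - E \<le> W k \<omega> * (q (S k \<omega>) * J (S k \<omega>))" for \<omega>
  proof -
    have "W k \<omega> * (c * subsol \<xi> (S k \<omega>) - E) \<le> W k \<omega> * (q (S k \<omega>) * J (S k \<omega>))"
      unfolding N_def c_def E_def q_def J_def
      by (intro mult_left_mono normal_density_subsol_step assms W01)
    moreover have "W k \<omega> * E \<le> E" using W01 E0 by (simp add: mult_left_le_one_le)
    ultimately show ?thesis by (simp add: algebra_simps)
  qed
  \<comment> \<open>Earlier errors are multiplied by \<open>c \<le> 1\<close>, hence do not grow,
    and one further \<open>E\<close> is added.\<close>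
  have "c ^ Suc k * subsol \<xi> 0 - real (Suc k) * E \<le> c * (c ^ k * subsol \<xi> 0 - real k * E) - E"
  proof -
    have "c * (real k * E) \<le> 1 * (real k * E)" using c E0 by (intro mult_right_mono) auto
    then show ?thesis by (simp add: algebra_simps)
  qed
  also have "\<dots> \<le> c * (\<integral>\<omega>. W k \<omega> * subsol \<xi> (S k \<omega>) \<partial>PiM {..<k} (\<lambda>_. N)) - E"
    using Suc.IH c unfolding c_def E_def W_def S_def
    by (intro diff_right_mono mult_left_mono)
  also have "\<dots> = (\<integral>\<omega>. c * (W k \<omega> * subsol \<xi> (S k \<omega>)) - E \<partial>PiM {..<k} (\<lambda>_. N))"
    using int[of k] by (simp add: prob_space.prob_space[OF prob_space_PiM[OF N.prob_space_axioms]])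
  also have "\<dots> \<le> (\<integral>\<omega>. (\<integral>y. W (Suc k) (\<omega> (k := y)) * subsol \<xi> (S (Suc k) (\<omega> (k := y))) \<partial>N) \<partial>PiM {..<k} (\<lambda>_. N))"
    unfolding fiber_eq
  proof (rule integral_mono)
    show "integrable (PiM {..<k} (\<lambda>_. N)) (\<lambda>\<omega>. c * (W k \<omega> * subsol \<xi> (S k \<omega>)) - E)"
      using int[of k] by simp
    show "integrable (PiM {..<k} (\<lambda>_. N)) (\<lambda>\<omega>. W k \<omega> * (q (S k \<omega>) * J (S k \<omega>)))"
      using measurable_compose[OF S_meas[OF order_refl[of k]] q_meas]
        measurable_compose[OF S_meas[OF order_refl[of k]] J_meas] W_meas[of k]
      by (intro P.integrable_const_bound[where B = 1])
         (auto simp: abs_mult W01 q01 J01 intro!: mult_le_one)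
  qed (rule fiber_ge)
  also have "\<dots> = (\<integral>\<omega>. W (Suc k) \<omega> * subsol \<xi> (S (Suc k) \<omega>) \<partial>PiM {..<Suc k} (\<lambda>_. N))"
    using int[of "Suc k"] unfolding lessThan_Suc
    by (intro P.product_integral_insert[symmetric]) auto
  finally show ?case
    unfolding c_def E_def W_def S_def .
qed

section \<open>Deterministic integrals: Riemann sums, the kernel in \<open>\<xi>\<close>, and a
  divergent integral\<close>

text \<open>Uniform continuity controls each grid interval. Left endpoints are used to match the
  weights of the walk.\<close>

lemma riemann_sum_LIMSEQ:
  fixes f :: "real \<Rightarrow> real"
  assumes cont: "continuous_on {0..t} f" and "t > 0"
  shows "(\<lambda>n. \<Sum>i<n. t / real n * f (t / real n * real i)) \<longlonglongrightarrow> integral {0..t} f"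
proof (rule LIMSEQ_I)
  fix e :: real assume "e > 0"
  \<comment> \<open>This tolerance per unit length gives a total error of \<open>e / 2\<close> over
    \<open>[0, t]\<close>, which leaves the final inequality strict.\<close>
  then have "e / (2 * t) > 0" using \<open>t > 0\<close> by simp
  moreover have "uniformly_continuous_on {0..t} f"
    using cont by (intro compact_uniformly_continuous) auto
  ultimately obtain d where d: "d > 0"
    "\<And>x y. x \<in> {0..t} \<Longrightarrow> y \<in> {0..t} \<Longrightarrow> dist y x < d \<Longrightarrow> dist (f y) (f x) < e / (2 * t)"
    unfolding uniformly_continuous_on_def by meson
  obtain n0 :: nat where n0: "t / d < real n0" using reals_Archimedean2 by blast
  have "norm ((\<Sum>i<n. t / real n * f (t / real n * real i)) - integral {0..t} f) < e" if "n \<ge> n0" for n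
  proof -
    have nd: "t / d < real n" using n0 that by linarith
    then have n: "n > 0" using \<open>t > 0\<close> \<open>d > 0\<close>
      by (metis divide_pos_pos less_trans of_nat_0_less_iff)
    define h where "h = t / real n"
    have h: "h > 0" "h < d" "h * real n = t"
      using nd n \<open>t > 0\<close> \<open>d > 0\<close> by (auto simp: h_def field_simps)
    have int: "f integrable_on {a..b}" if "0 \<le> a" "b \<le> t" for a b
      using continuous_on_subset[OF cont] that by (intro integrable_continuous_real) auto
    have le_t: "h * real i \<le> t" if "i \<le> n" for i
      using that h(1) unfolding h(3)[symmetric] by simp
    have split: "integral {0..h * real k} f = (\<Sum>i<k. integral {h * real i..h * real (Suc i)} f)" if "k \<le> n" for k
      using that
    proof (induction k)
      case (Suc k)
      have "integral {0..h * real k} f + integral {h * real k..h * real (Suc k)} f = integral {0..h * real (Suc k)} f"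
        using h le_t[OF Suc.prems] by (intro Henstock_Kurzweil_Integration.integral_combine int) auto
      then show ?case using Suc by simp
    qed simp
    have piece: "\<bar>h * f (h * real i) - integral {h * real i..h * real (Suc i)} f\<bar> \<le> h * (e / (2 * t))" if "i < n" for i
    proof -
      let ?a = "h * real i" and ?b = "h * real (Suc i)"
      have ab: "0 \<le> ?a" "?a \<le> ?b" "?b \<le> t" "?b - ?a = h"
        using h le_t[of "Suc i"] that by (auto simp: algebra_simps)
      have c': "continuous_on {?a..?b} f"
        using continuous_on_subset[OF cont] ab by auto
      have "norm (integral {?a..?b} (\<lambda>x. f ?a - f x)) \<le> e / (2 * t) * (?b - ?a)"
      proof (rule integral_bound)
        fix x assume x: "x \<in> {?a..?b}"
        then have "dist ?a x < d" using ab h by (auto simp: dist_real_def)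
        moreover have "x \<in> {0..t}" "?a \<in> {0..t}"
          using x ab(1-3) unfolding atLeastAtMost_iff by (blast intro: order_trans)+
        ultimately show "norm (f ?a - f x) \<le> e / (2 * t)"
          using d(2)[of x ?a] by (simp add: dist_real_def)
      qed (use ab c' in \<open>auto intro!: continuous_intros\<close>)
      moreover have "integral {?a..?b} (\<lambda>x. f ?a - f x) = h * f ?a - integral {?a..?b} f"
        using ab int[of ?a ?b] by (subst Henstock_Kurzweil_Integration.integral_diff) auto
      ultimately show ?thesis using ab(4) by (simp add: mult.commute)
    qed
    have "\<bar>(\<Sum>i<n. h * f (h * real i)) - integral {0..t} f\<bar>
        = \<bar>\<Sum>i<n. h * f (h * real i) - integral {h * real i..h * real (Suc i)} f\<bar>"
      using split[of n] h(3) by (simp add: sum_subtractf)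
    also have "\<dots> \<le> (\<Sum>i<n. h * (e / (2 * t)))"
      by (rule order_trans[OF sum_abs]) (intro sum_mono piece, simp)
    also have "\<dots> = (h * real n) * (e / (2 * t))" by simp
    also have "\<dots> < e" unfolding h(3) using \<open>e > 0\<close> \<open>t > 0\<close> by simp
    finally show ?thesis unfolding h_def by simp
  qed
  then show "\<exists>n0. \<forall>n\<ge>n0. norm ((\<Sum>i<n. t / real n * f (t / real n * real i)) - integral {0..t} f) < e"
    by blast
qed

text \<open>Completing the square leaves \<open>exp (2 / a)\<close> times a Gaussian profile with
  mean and variance \<open>4 / a\<close>. Its mass is of order \<open>1 / sqrt a\<close>, and
  \<open>1 / sqrt (1 + \<xi>)\<close> compensates this near the mean, making the constant uniform as
  \<open>a\<close> tends to 0.\<close>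

lemma nn_integral_exp_kernel_le:
  fixes a :: real
  assumes "a > 0"
  shows "(\<integral>\<^sup>+\<xi>. ennreal (exp (\<xi> - \<xi>\<^sup>2 / 8 * a) / sqrt (1 + \<xi>)) * indicator {0..} \<xi> \<partial>lborel)
    \<le> ennreal (4 + 2 * sqrt pi) * ennreal (exp (2 / a))"
proof -
  define \<sigma> where "\<sigma> = sqrt (4 / a)"
  have \<sigma>: "\<sigma> > 0" "\<sigma>\<^sup>2 = 4 / a" using assms by (auto simp: \<sigma>_def)
  let ?n = "normal_density (4 / a) \<sigma>"
  have sq: "exp (\<xi> - \<xi>\<^sup>2 / 8 * a) = exp (2 / a) * exp (- (\<xi> - 4 / a)\<^sup>2 / (2 * \<sigma>\<^sup>2))" for \<xi>
    unfolding \<sigma> exp_add[symmetric] using assms by (simp add: power2_eq_square field_simps)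
  \<comment> \<open>Split at half the mean. Below it the Gaussian exponent is at most
    \<open>- 1 / (2 * a)\<close>; above it \<open>1 / sqrt (1 + \<xi>) \<le> sqrt (a / 2)\<close>,
    which is \<open>2 * sqrt pi\<close> times the normalising constant of the density.\<close>
  have pw: "exp (- (\<xi> - 4 / a)\<^sup>2 / (2 * \<sigma>\<^sup>2)) / sqrt (1 + \<xi>)
      \<le> exp (- (1 / (2 * a))) * indicator {0..2 / a} \<xi> + 2 * sqrt pi * ?n \<xi>" if "\<xi> \<ge> 0" for \<xi>
  proof (cases "\<xi> \<le> 2 / a")
    case True
    have "(2 / a)\<^sup>2 \<le> (4 / a - \<xi>)\<^sup>2"
      using True assms by (intro power_mono) (auto simp: field_simps)
    then have "(2 / a)\<^sup>2 * a / 8 \<le> (\<xi> - 4 / a)\<^sup>2 * a / 8"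
      using assms by (simp add: power2_commute)
    then have "- (\<xi> - 4 / a)\<^sup>2 / (2 * \<sigma>\<^sup>2) \<le> - (1 / (2 * a))"
      unfolding \<sigma> using assms by (simp add: power2_eq_square)
    then have "exp (- (\<xi> - 4 / a)\<^sup>2 / (2 * \<sigma>\<^sup>2)) / sqrt (1 + \<xi>) \<le> exp (- (1 / (2 * a))) / 1"
      using that by (intro frac_le) auto
    then show ?thesis using True that \<sigma> by (simp add: add_increasing2)
  next
    case False
    have "1 / sqrt (1 + \<xi>) \<le> 1 / sqrt (2 / a)"
      using False that assms by (intro divide_left_mono) auto
    also have "\<dots> = 2 * sqrt pi / sqrt (2 * pi * \<sigma>\<^sup>2)"
    proof -
      have "2 * pi * \<sigma>\<^sup>2 = (2 * sqrt pi)\<^sup>2 * (2 / a)"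
        unfolding \<sigma> by (simp add: power_mult_distrib)
      then show ?thesis using assms by (simp only: real_sqrt_mult real_sqrt_abs) simp
    qed
    finally have "exp (- (\<xi> - 4 / a)\<^sup>2 / (2 * \<sigma>\<^sup>2)) * (1 / sqrt (1 + \<xi>))
       \<le> exp (- (\<xi> - 4 / a)\<^sup>2 / (2 * \<sigma>\<^sup>2)) * (2 * sqrt pi / sqrt (2 * pi * \<sigma>\<^sup>2))"
      by (intro mult_left_mono) auto
    then show ?thesis using False by (simp add: normal_density_def mult_ac)
  qed
  have N: "(\<integral>\<^sup>+\<xi>. ennreal (?n \<xi>) \<partial>lborel) = 1"
    using prob_space.emeasure_space_1[OF prob_space_normal_density[OF \<sigma>(1)], of "4 / a"]
    by (simp add: emeasure_density)
  \<comment> \<open>The lower piece has length \<open>2 / a = 4 * y\<close> with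
    \<open>y = 1 / (2 * a)\<close>, so its contribution \<open>4 * y * exp (- y)\<close> is bounded
    uniformly in \<open>a\<close>.\<close>
  have U: "ennreal (exp (- (1 / (2 * a)))) * ennreal (2 / a) \<le> ennreal 4"
  proof -
    define y where "y = 1 / (2 * a)"
    have "y \<le> exp y" using exp_ge_add_one_self[of y] by linarith
    then have "exp (- y) * (4 * y) \<le> 4" by (simp add: exp_minus field_simps)
    then have "ennreal (exp (- (1 / (2 * a))) * (2 / a)) \<le> ennreal 4"
      by (intro ennreal_leI) (simp add: y_def field_simps)
    then show ?thesis using assms by (simp only: ennreal_mult'[symmetric] exp_ge_zero)
  qed
  have "(\<integral>\<^sup>+\<xi>. ennreal (exp (\<xi> - \<xi>\<^sup>2 / 8 * a) / sqrt (1 + \<xi>)) * indicator {0..} \<xi> \<partial>lborel)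
    \<le> (\<integral>\<^sup>+\<xi>. ennreal (exp (2 / a)) * (ennreal (exp (- (1 / (2 * a)))) * indicator {0..2 / a} \<xi>
          + ennreal (2 * sqrt pi) * ennreal (?n \<xi>)) \<partial>lborel)"
  proof (rule nn_integral_mono)
    fix \<xi> :: real
    show "ennreal (exp (\<xi> - \<xi>\<^sup>2 / 8 * a) / sqrt (1 + \<xi>)) * indicator {0..} \<xi>
      \<le> ennreal (exp (2 / a)) * (ennreal (exp (- (1 / (2 * a)))) * indicator {0..2 / a} \<xi>
          + ennreal (2 * sqrt pi) * ennreal (?n \<xi>))"
    proof (cases "\<xi> \<ge> 0")
      case True
      have "exp (\<xi> - \<xi>\<^sup>2 / 8 * a) / sqrt (1 + \<xi>)
         \<le> exp (2 / a) * (exp (- (1 / (2 * a))) * indicator {0..2 / a} \<xi> + 2 * sqrt pi * ?n \<xi>)"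
        unfolding sq using mult_left_mono[OF pw[OF True], of "exp (2 / a)"] by simp
      then have "ennreal (exp (\<xi> - \<xi>\<^sup>2 / 8 * a) / sqrt (1 + \<xi>))
         \<le> ennreal (exp (2 / a) * (exp (- (1 / (2 * a))) * indicator {0..2 / a} \<xi> + 2 * sqrt pi * ?n \<xi>))"
        by (rule ennreal_leI)
      also have "\<dots> = ennreal (exp (2 / a)) * (ennreal (exp (- (1 / (2 * a)))) * indicator {0..2 / a} \<xi>
          + ennreal (2 * sqrt pi) * ennreal (?n \<xi>))"
        by (simp add: ennreal_mult' ennreal_plus ennreal_indicator del: ennreal_plus[symmetric])
      finally show ?thesis using True by simp
    qed simp
  qed
  also have "\<dots> = ennreal (exp (2 / a)) * (ennreal (exp (- (1 / (2 * a)))) * ennreal (2 / a) + ennreal (2 * sqrt pi))"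
    using assms N by (simp add: nn_integral_cmult nn_integral_add)
  also have "\<dots> \<le> ennreal (exp (2 / a)) * (ennreal 4 + ennreal (2 * sqrt pi))"
    using U by (intro mult_left_mono add_right_mono) auto
  also have "\<dots> = ennreal (4 + 2 * sqrt pi) * ennreal (exp (2 / a))"
    by (simp add: ennreal_plus mult.commute)
  finally show ?thesis .
qed

lemma nn_integral_inverse_one_plus_eq_top:
  "(\<integral>\<^sup>+\<xi>. ennreal (1 / (1 + \<xi>)) * indicator {0..} \<xi> \<partial>lborel) = (\<infinity> :: ennreal)"
proof -
  have "ennreal (ln (1 + real n)) \<le> (\<integral>\<^sup>+\<xi>. ennreal (1 / (1 + \<xi>)) * indicator {0..} \<xi> \<partial>lborel)" for n
  proof -
    have "ennreal (ln (1 + real n)) = ennreal (ln (1 + real n) - ln (1 + 0))" by simp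
    also have "\<dots> = (\<integral>\<^sup>+\<xi>. ennreal (1 / (1 + \<xi>)) * indicator {0..real n} \<xi> \<partial>lborel)"
      by (rule nn_integral_FTC_Icc[symmetric]) (auto intro!: derivative_eq_intros)
    also have "\<dots> \<le> (\<integral>\<^sup>+\<xi>. ennreal (1 / (1 + \<xi>)) * indicator {0..} \<xi> \<partial>lborel)"
      by (intro nn_integral_mono) (auto simp: indicator_def)
    finally show ?thesis .
  qed
  note le = this
  show ?thesis
  proof (rule ccontr)
    assume "\<not> ?thesis"
    then obtain r where r: "r \<ge> 0"
      "(\<integral>\<^sup>+\<xi>. ennreal (1 / (1 + \<xi>)) * indicator {0..} \<xi> \<partial>lborel) = ennreal r"
      by (cases "\<integral>\<^sup>+\<xi>. ennreal (1 / (1 + \<xi>)) * indicator {0..} \<xi> \<partial>lborel" rule: ennreal_cases) auto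
    obtain n :: nat where n: "exp r < real n" using reals_Archimedean2 by blast
    have "ln (1 + real n) \<le> r" using le[of n] r by simp
    moreover have "r < ln (1 + real n)"
      using n by (subst ln_exp[of r, symmetric], subst ln_less_cancel_iff) auto
    ultimately show False by simp
  qed
qed

section \<open>The Laplace transform of the exponential functional of Brownian motion\<close>

context standard_brownian_motion
begin

lemma distr_increment:
  assumes "0 \<le> s" "s < u"
  shows "distr M borel (\<lambda>\<omega>. B u \<omega> - B s \<omega>) = density lborel (normal_density 0 (sqrt (u - s)))"
  using distributed_distr_eq_density[OF normal_increments[OF assms]]
  by (simp cong: distr_cong)

text \<open>On a grid of mesh \<open>h\<close> the Brownian increments form the Gaussian walk with
  \<open>\<sigma> = sqrt h\<close>, so the walk bound applies.\<close>

lemma riemann_sum_exp_functional_ge: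
  assumes "\<xi> \<ge> 0" "h > 0" "3 / 16 * h \<le> 1" "n > 0"
  shows "(1 - 3 / 16 * h) ^ n * subsol \<xi> 0 - real n * (4 * h\<^sup>2 + 18 * (h * sqrt h))
    \<le> expectation (\<lambda>\<omega>. exp (- (\<xi>\<^sup>2 / 8 * (\<Sum>i<n. h * exp (B (h * real i) \<omega>)))))"
proof -
  define N where "N = density lborel (normal_density 0 (sqrt h))"
  define D where "D i \<omega> = B (h * real (Suc i)) \<omega> - B (h * real i) \<omega>" for i \<omega>
  define G where "G \<omega> = exp (- (\<xi>\<^sup>2 / 8 * (\<Sum>i<n. h * exp (\<Sum>j<i. \<omega> j))))" for \<omega> :: "nat \<Rightarrow> real"
  interpret N: prob_space N
    unfolding N_def using assms by (intro prob_space_normal_density) simp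
  interpret P: product_prob_space "\<lambda>_::nat. N" "{..<n}" ..
  have D_rv: "random_variable borel (D i)" for i
    unfolding D_def[abs_def] using assms by (intro borel_measurable_diff random_variable_B) auto
  have D_law: "distr M borel (D i) = N" for i
    unfolding D_def[abs_def] N_def using assms
    by (subst distr_increment) (auto simp: algebra_simps)
  have "indep_vars (\<lambda>_. borel) D {..<n}"
    unfolding D_def[abs_def] using assms
    by (intro indep_increments[of "\<lambda>i. h * real i"]) auto
  \<comment> \<open>Independence becomes a product law through a characterisation for nonempty index
    sets, which \<open>n > 0\<close> provides.\<close>
  then have joint: "distr M (PiM {..<n} (\<lambda>_. borel)) (\<lambda>\<omega>. \<lambda>i\<in>{..<n}. D i \<omega>) = PiM {..<n} (\<lambda>_. N)"
    using indep_vars_iff_distr_eq_PiM'[where I = "{..<n}" and M' = "\<lambda>_. borel" and X = D] D_rv assms(4)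
    by (auto simp: D_law lessThan_empty_iff)
  have comp: "(\<lambda>\<omega>. \<omega> j) \<in> borel_measurable (PiM {..<n} (\<lambda>_. borel :: real measure))" if "j < n" for j
    using that by (intro measurable_component_singleton) auto
  have G_meas: "G \<in> borel_measurable (PiM {..<n} (\<lambda>_. borel))"
    unfolding G_def[abs_def]
    by (intro borel_measurable_exp[THEN measurable_compose_rev] borel_measurable_uminus
        borel_measurable_times borel_measurable_sum borel_measurable_const comp) auto
  have sets_eq: "sets (PiM {..<n} (\<lambda>_. N)) = sets (PiM {..<n} (\<lambda>_. borel))"
    by (intro sets_PiM_cong) (auto simp: N_def)
  have S_meas: "(\<lambda>\<omega>. \<Sum>j<n. \<omega> j) \<in> borel_measurable (PiM {..<n} (\<lambda>_. N))"
    unfolding measurable_cong_sets[OF sets_eq refl] by (intro borel_measurable_sum comp) auto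
  have G_meas': "G \<in> borel_measurable (PiM {..<n} (\<lambda>_. N))"
    using G_meas unfolding measurable_cong_sets[OF sets_eq refl] .
  have G01: "0 \<le> G \<omega>" "G \<omega> \<le> 1" for \<omega>
    using assms by (auto simp: G_def intro!: sum_nonneg mult_nonneg_nonneg)
  have f01: "0 \<le> subsol \<xi> x" "subsol \<xi> x \<le> 1" for x
    using subsol_pos[OF assms(1), of x] subsol_le_1[OF assms(1), of x] by auto
  have h: "sqrt h > 0" "(sqrt h)\<^sup>2 = h" "sqrt h ^ 4 = h\<^sup>2" "sqrt h ^ 3 = h * sqrt h"
    using assms by (auto simp: power3_eq_cube power4_eq_xxxx power2_eq_square)
  have "(1 - 3 / 16 * h) ^ n * subsol \<xi> 0 - real n * (4 * h\<^sup>2 + 18 * (h * sqrt h))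
    \<le> (\<integral>\<omega>. G \<omega> * subsol \<xi> (\<Sum>j<n. \<omega> j) \<partial>PiM {..<n} (\<lambda>_. N))"
    using normal_walk_subsol_bound[OF assms(1) h(1), of n] assms(3)
    unfolding G_def N_def h by simp
  \<comment> \<open>The terminal value of \<open>subsol\<close> has done its work in the induction
    and is now bounded by 1.\<close>
  also have "\<dots> \<le> (\<integral>\<omega>. G \<omega> \<partial>PiM {..<n} (\<lambda>_. N))"
  proof (rule integral_mono)
    show "integrable (PiM {..<n} (\<lambda>_. N)) G"
      using G_meas' G01 by (intro P.integrable_const_bound[where B = 1]) auto
    show "integrable (PiM {..<n} (\<lambda>_. N)) (\<lambda>\<omega>. G \<omega> * subsol \<xi> (\<Sum>j<n. \<omega> j))"
      using measurable_compose[OF S_meas borel_measurable_subsol[of \<xi>]] G_meas'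
      by (intro P.integrable_const_bound[where B = 1])
         (auto simp: abs_mult G01 f01 intro!: mult_le_one)
    show "G \<omega> * subsol \<xi> (\<Sum>j<n. \<omega> j) \<le> G \<omega>" for \<omega>
      using G01 f01 by (simp add: mult_left_le)
  qed
  also have "\<dots> = (\<integral>\<omega>. G (\<lambda>i\<in>{..<n}. D i \<omega>) \<partial>M)"
    unfolding joint[symmetric] using D_rv by (intro integral_distr G_meas measurable_restrict) auto
  also have "\<dots> = expectation (\<lambda>\<omega>. exp (- (\<xi>\<^sup>2 / 8 * (\<Sum>i<n. h * exp (B (h * real i) \<omega>)))))"
  proof (rule integral_cong_AE)
    show "(\<lambda>\<omega>. G (\<lambda>i\<in>{..<n}. D i \<omega>)) \<in> borel_measurable M"
      using D_rv by (intro measurable_compose[OF _ G_meas] measurable_restrict) auto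
    have "random_variable borel (B (h * real i))" for i
      using assms by (intro random_variable_B) auto
    then show "random_variable borel (\<lambda>\<omega>. exp (- (\<xi>\<^sup>2 / 8 * (\<Sum>i<n. h * exp (B (h * real i) \<omega>)))))"
      by measurable
    \<comment> \<open>Increments telescope to \<open>B (h * real i) - B 0\<close>, and
      \<open>B 0\<close> vanishes only almost surely.\<close>
    show "AE \<omega> in M. G (\<lambda>i\<in>{..<n}. D i \<omega>) = exp (- (\<xi>\<^sup>2 / 8 * (\<Sum>i<n. h * exp (B (h * real i) \<omega>))))"
      using start_zero
    proof eventually_elim
      case (elim \<omega>)
      have "(\<Sum>j<i. (\<lambda>i\<in>{..<n}. D i \<omega>) j) = B (h * real i) \<omega>" if "i < n" for i
      proof -
        have "(\<Sum>j<i. (\<lambda>i\<in>{..<n}. D i \<omega>) j) = (\<Sum>j<i. D j \<omega>)"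
          using that by (intro sum.cong) auto
        also have "\<dots> = B (h * real i) \<omega> - B (h * real 0) \<omega>"
          unfolding D_def by (rule sum_lessThan_telescope)
        finally show ?thesis using elim by simp
      qed
      then show ?case unfolding G_def by simp
    qed
  qed
  finally show ?thesis .
qed

text \<open>Holds on every path continuous on \<open>[0, \<infinity>)\<close>; positivity comes from
  the minimum over the compact interval and is what the kernel bound requires of
  \<open>a\<close>.\<close>

lemma riemann_sum_exp_functional_LIMSEQ:
  assumes "t > 0"
  shows "AE \<omega> in M. (\<lambda>n. \<Sum>i<n. t / real n * exp (B (t / real n * real i) \<omega>))
      \<longlonglongrightarrow> (LBINT s:{0..t}. exp (B s \<omega>)) \<and> 0 < (LBINT s:{0..t}. exp (B s \<omega>))"
  using continuous_paths
proof eventually_elim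
  case (elim \<omega>)
  have c: "continuous_on {0..t} (\<lambda>s. exp (B s \<omega>))"
    by (intro continuous_intros continuous_on_subset[OF elim]) auto
  have eq: "(LBINT s:{0..t}. exp (B s \<omega>)) = integral {0..t} (\<lambda>s. exp (B s \<omega>))"
    by (intro set_borel_integral_eq_integral borel_integrable_atLeastAtMost' c)
  obtain m where m: "\<And>s. s \<in> {0..t} \<Longrightarrow> exp (B m \<omega>) \<le> exp (B s \<omega>)"
    using continuous_attains_inf[OF compact_Icc _ c] assms by force
  have "0 < t * exp (B m \<omega>)" using assms by simp
  also have "\<dots> = integral {0..t} (\<lambda>_. exp (B m \<omega>))" using assms by simp
  also have "\<dots> \<le> integral {0..t} (\<lambda>s. exp (B s \<omega>))"
    using m by (intro integral_le integrable_continuous_real c) auto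
  finally show ?case
    using riemann_sum_LIMSEQ[OF c assms] unfolding eq by auto
qed

text \<open>Refine the grid with \<open>h = t / n\<close>: the accumulated error is of order
  \<open>1 / sqrt n\<close>, the product of the step factors tends to
  \<open>exp (- (3 / 16 * t))\<close>, and dominated convergence handles the expectations, all
  integrands being at most 1.\<close>

lemma laplace_exp_functional_ge:
  assumes "\<xi> \<ge> 0" "t > 0" and A: "random_variable borel A"
    and lim: "AE \<omega> in M. (\<lambda>n. \<Sum>i<n. t / real n * exp (B (t / real n * real i) \<omega>)) \<longlonglongrightarrow> A \<omega>"
  shows "exp (- (3 / 16 * t)) * subsol \<xi> 0 \<le> expectation (\<lambda>\<omega>. exp (- (\<xi>\<^sup>2 / 8 * A \<omega>)))"
proof -
  define S where "S n \<omega> = (\<Sum>i<n. t / real n * exp (B (t / real n * real i) \<omega>))" for n \<omega>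
  have "(\<lambda>n. expectation (\<lambda>\<omega>. exp (- (\<xi>\<^sup>2 / 8 * S n \<omega>)))) \<longlonglongrightarrow> expectation (\<lambda>\<omega>. exp (- (\<xi>\<^sup>2 / 8 * A \<omega>)))"
  proof (rule integral_dominated_convergence[where w = "\<lambda>_. 1"])
    show "random_variable borel (\<lambda>\<omega>. exp (- (\<xi>\<^sup>2 / 8 * A \<omega>)))"
      using A by measurable
    have "random_variable borel (B (t / real n * real i))" for i n
      using assms by (intro random_variable_B) auto
    then show "random_variable borel (\<lambda>\<omega>. exp (- (\<xi>\<^sup>2 / 8 * S n \<omega>)))" for n
      unfolding S_def by measurable
    show "AE \<omega> in M. (\<lambda>n. exp (- (\<xi>\<^sup>2 / 8 * S n \<omega>))) \<longlonglongrightarrow> exp (- (\<xi>\<^sup>2 / 8 * A \<omega>))"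
      using lim by eventually_elim (auto simp: S_def intro!: tendsto_intros)
    show "AE \<omega> in M. norm (exp (- (\<xi>\<^sup>2 / 8 * S n \<omega>))) \<le> 1" for n
      using assms by (auto simp: S_def intro!: AE_I2 sum_nonneg mult_nonneg_nonneg)
  qed simp
  moreover have "(\<lambda>n. (1 - 3 / 16 * (t / real n)) ^ n * subsol \<xi> 0
      - real n * (4 * (t / real n)\<^sup>2 + 18 * (t / real n * sqrt (t / real n)))) \<longlonglongrightarrow> exp (- (3 / 16 * t)) * subsol \<xi> 0 - 0"
  proof (intro tendsto_diff tendsto_mult tendsto_const)
    show "(\<lambda>n. (1 - 3 / 16 * (t / real n)) ^ n) \<longlonglongrightarrow> exp (- (3 / 16 * t))"
      using tendsto_exp_limit_sequentially[of "- (3 / 16 * t)"] by simp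
    have "(\<lambda>n. 4 * t * (t / real n) + 18 * t * sqrt (t / real n)) \<longlonglongrightarrow> 4 * t * 0 + 18 * t * sqrt 0"
      by (intro tendsto_intros lim_const_over_n)
    moreover have "\<forall>\<^sub>F n in sequentially. 4 * t * (t / real n) + 18 * t * sqrt (t / real n)
        = real n * (4 * (t / real n)\<^sup>2 + 18 * (t / real n * sqrt (t / real n)))"
      using eventually_gt_at_top[of 0]
      by eventually_elim (simp add: power2_eq_square field_simps)
    ultimately show "(\<lambda>n. real n * (4 * (t / real n)\<^sup>2 + 18 * (t / real n * sqrt (t / real n)))) \<longlonglongrightarrow> 0"
      by (simp add: Lim_transform_eventually)
  qed
  moreover have "\<forall>\<^sub>F n in sequentially. (1 - 3 / 16 * (t / real n)) ^ n * subsol \<xi> 0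
      - real n * (4 * (t / real n)\<^sup>2 + 18 * (t / real n * sqrt (t / real n)))
      \<le> expectation (\<lambda>\<omega>. exp (- (\<xi>\<^sup>2 / 8 * S n \<omega>)))"
  proof -
    obtain n0 :: nat where n0: "t < real n0" using reals_Archimedean2 by blast
    show ?thesis
      using eventually_ge_at_top[of n0]
    proof eventually_elim
      case (elim n)
      then have n: "t < real n" using n0 by linarith
      then have "n > 0" using assms(2) by (cases n) auto
      moreover have "3 / 16 * (t / real n) \<le> 1" using n assms(2) by (simp add: field_simps)
      ultimately show ?case
        unfolding S_def using assms by (intro riemann_sum_exp_functional_ge) auto
    qed
  qed
  ultimately show ?thesis
    by (intro tendsto_le[OF sequentially_bot]) auto
qed

end

section \<open>Divergence of the exponential moment by Tonelli\<close>

theorem corollary5p4: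
  fixes M :: "'a measure" and B :: "real \<Rightarrow> 'a \<Rightarrow> real" and t :: real
  assumes "standard_brownian_motion M B"
    and "t > 0"
  shows "(\<integral>\<^sup>+ \<omega>. ennreal (exp (2 / (LBINT s:{0..t}. exp (B s \<omega>)))) \<partial>M) = \<infinity>"
proof -
  interpret standard_brownian_motion M B by fact
  \<comment> \<open>As a \<open>lim\<close> of Riemann sums, \<open>A\<close> is a random variable
    by construction. It agrees with the pathwise integral only almost surely, since paths may be
    discontinuous on a null set.\<close>
  define A where "A \<omega> = lim (\<lambda>n. \<Sum>i<n. t / real n * exp (B (t / real n * real i) \<omega>))" for \<omega>
  have B_rv: "random_variable borel (B (t / real n * real i))" for i n
    using assms(2) by (intro random_variable_B) auto
  have A_rv [measurable]: "random_variable borel A"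
    unfolding A_def[abs_def]
    by (intro borel_measurable_lim_metric borel_measurable_sum borel_measurable_times borel_measurable_const
        borel_measurable_exp[THEN measurable_compose_rev] B_rv)
  have A_eq: "AE \<omega> in M. A \<omega> = (LBINT s:{0..t}. exp (B s \<omega>))"
    using riemann_sum_exp_functional_LIMSEQ[OF assms(2)]
    by eventually_elim (auto simp: A_def intro: limI)
  have A_lim: "AE \<omega> in M. (\<lambda>n. \<Sum>i<n. t / real n * exp (B (t / real n * real i) \<omega>)) \<longlonglongrightarrow> A \<omega>"
    and A_pos: "AE \<omega> in M. 0 < A \<omega>"
    using riemann_sum_exp_functional_LIMSEQ[OF assms(2)] A_eq by (eventually_elim, simp)+
  interpret pair_sigma_finite M lborel ..
  define K where "K \<xi> a = ennreal (exp (\<xi> - \<xi>\<^sup>2 / 8 * a) / sqrt (1 + \<xi>)) * indicator {0..} \<xi>" for \<xi> a :: real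
  define c where "c = ennreal (exp (- (3 / 16 * t)))"
  \<comment> \<open>Multiplying the Laplace bound by \<open>exp \<xi> / sqrt (1 + \<xi>)\<close>
    cancels \<open>exp (- \<xi>)\<close> and pairs the two square roots into
    \<open>1 / (1 + \<xi>)\<close>, whose integral just fails to converge.\<close>
  have L: "c * (ennreal (1 / (1 + \<xi>)) * indicator {0..} \<xi>) \<le> (\<integral>\<^sup>+\<omega>. K \<xi> (A \<omega>) \<partial>M)" for \<xi>
  proof (cases "\<xi> \<ge> 0")
    case True
    have int: "integrable M (\<lambda>\<omega>. exp (- (\<xi>\<^sup>2 / 8 * A \<omega>)))"
      using A_pos by (intro integrable_const_bound[where B = 1]) (auto elim!: eventually_mono)
    have "exp (- (3 / 16 * t)) * (1 / (1 + \<xi>)) = exp \<xi> / sqrt (1 + \<xi>) * (exp (- (3 / 16 * t)) * subsol \<xi> 0)"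
    proof -
      have "1 / (1 + \<xi>) = 1 / sqrt (1 + \<xi>) * (1 / sqrt (1 + \<xi>))"
        using True by simp
      then show ?thesis by (simp add: subsol_def exp_minus)
    qed
    also have "\<dots> \<le> exp \<xi> / sqrt (1 + \<xi>) * expectation (\<lambda>\<omega>. exp (- (\<xi>\<^sup>2 / 8 * A \<omega>)))"
      using True assms(2) A_lim by (intro mult_left_mono laplace_exp_functional_ge) auto
    finally have "c * ennreal (1 / (1 + \<xi>))
        \<le> ennreal (exp \<xi> / sqrt (1 + \<xi>)) * ennreal (expectation (\<lambda>\<omega>. exp (- (\<xi>\<^sup>2 / 8 * A \<omega>))))"
      unfolding c_def using True by (simp add: ennreal_leI flip: ennreal_mult)
    also have "\<dots> = (\<integral>\<^sup>+\<omega>. ennreal (exp \<xi> / sqrt (1 + \<xi>)) * ennreal (exp (- (\<xi>\<^sup>2 / 8 * A \<omega>))) \<partial>M)"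
      using int by (simp add: nn_integral_eq_integral nn_integral_cmult)
    also have "\<dots> = (\<integral>\<^sup>+\<omega>. K \<xi> (A \<omega>) \<partial>M)"
    proof (rule nn_integral_cong)
      fix \<omega>
      have eq: "exp (\<xi> - \<xi>\<^sup>2 / 8 * A \<omega>) / sqrt (1 + \<xi>) = exp \<xi> / sqrt (1 + \<xi>) * exp (- (\<xi>\<^sup>2 / 8 * A \<omega>))"
        by (simp add: mult_exp_exp)
      show "ennreal (exp \<xi> / sqrt (1 + \<xi>)) * ennreal (exp (- (\<xi>\<^sup>2 / 8 * A \<omega>))) = K \<xi> (A \<omega>)"
        unfolding K_def eq using True by (subst ennreal_mult'[symmetric]) auto
    qed
    finally show ?thesis using True by simp
  qed simp
  have "\<infinity> = c * (\<integral>\<^sup>+\<xi>. ennreal (1 / (1 + \<xi>)) * indicator {0..} \<xi> \<partial>lborel)"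
    unfolding nn_integral_inverse_one_plus_eq_top by (simp add: c_def ennreal_mult_top)
  also have "\<dots> = (\<integral>\<^sup>+\<xi>. c * (ennreal (1 / (1 + \<xi>)) * indicator {0..} \<xi>) \<partial>lborel)"
    by (rule nn_integral_cmult[symmetric]) auto
  also have "\<dots> \<le> (\<integral>\<^sup>+\<xi>. (\<integral>\<^sup>+\<omega>. K \<xi> (A \<omega>) \<partial>M) \<partial>lborel)"
    by (intro nn_integral_mono L)
  also have "\<dots> = (\<integral>\<^sup>+\<omega>. (\<integral>\<^sup>+\<xi>. K \<xi> (A \<omega>) \<partial>lborel) \<partial>M)"
    by (rule Fubini'[of "\<lambda>\<omega> \<xi>. K \<xi> (A \<omega>)"]) (auto simp: K_def)
  also have "\<dots> \<le> (\<integral>\<^sup>+\<omega>. ennreal (4 + 2 * sqrt pi) * ennreal (exp (2 / A \<omega>)) \<partial>M)"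
    unfolding K_def using A_pos
    by (intro nn_integral_mono_AE) (erule eventually_mono, rule nn_integral_exp_kernel_le)
  also have "\<dots> = ennreal (4 + 2 * sqrt pi) * (\<integral>\<^sup>+\<omega>. ennreal (exp (2 / A \<omega>)) \<partial>M)"
    by (rule nn_integral_cmult) auto
  \<comment> \<open>The constant in front is finite, so the other factor must be infinite.\<close>
  finally have "(\<integral>\<^sup>+\<omega>. ennreal (exp (2 / A \<omega>)) \<partial>M) = \<infinity>"
    by (auto simp: top_unique ennreal_mult_eq_top_iff)
  moreover have "(\<integral>\<^sup>+\<omega>. ennreal (exp (2 / A \<omega>)) \<partial>M)
      = (\<integral>\<^sup>+ \<omega>. ennreal (exp (2 / (LBINT s:{0..t}. exp (B s \<omega>)))) \<partial>M)"
    using A_eq by (intro nn_integral_cong_AE) (auto elim!: eventually_mono)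
  ultimately show ?thesis by simp
qed

end
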